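(* Let $\kappa$ be an uncountable cardinal and let $$\mathrm{CUB}=\{\eta\in{}^{\kappa}2:\text{ there is a closed unbounded set } C\subseteq\kappa \text{ such that } \eta(i)=1 \text{ for all } i\in C\}.$$ Then there is a system $\langle A_\nu:\nu\in{}^{<\kappa}\kappa\rangle$ of open subsets of ${}^{\kappa}2$ such that $$\mathrm{CUB}=\bigcup_{f\in{}^{\kappa}\kappa}\ \bigcap_{i<\kappa}A_{f\restriction i}.$$
   Context: ${}^{\kappa}2$ is the set of functions $\kappa\to\{0,1\}$, ${}^{\kappa}\kappa$ is the set of functions $\kappa\to\kappa$, and ${}^{<\kappa}\kappa=\bigcup_{i<\kappa}{}^{i}\kappa$. For $\nu\in{}^{<\kappa}2=\bigcup_{i<\kappa}{}^{i}2$ put $[\nu]=\{\eta\in{}^{\kappa}2:\nu\subseteq\eta\}$. A set $A\subseteq{}^{\kappa}2$ is open if for every $\eta\in A$ there is $i<\kappa$ with $[\eta\restriction i]\subseteq A$. *)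

theory Defs
  imports Main "HOL-Library.Countable_Set"
begin

text \<open>
  A cardinal is a relation \<open>\<kappa>\<close> with \<^term>\<open>Card_order \<kappa>\<close>. The ordinals \<open>i < \<kappa>\<close> are the elements
  of \<^term>\<open>Field \<kappa>\<close>, and such an \<open>i\<close>, regarded as the set of smaller ordinals, is
  \<^term>\<open>underS \<kappa> i\<close>. Functions between sets are partial maps with a prescribed domain, so that the
  length of a sequence is determined by the sequence, and \<open>\<nu> \<subseteq> \<eta>\<close> is \<open>\<nu> \<subseteq>\<^sub>m \<eta>\<close>.
\<close>

definition funs :: "'a set \<Rightarrow> 'b set \<Rightarrow> ('a \<rightharpoonup> 'b) set" where
  "funs X Y = {f. dom f = X \<and> ran f \<subseteq> Y}"

definition short_funs :: "'a rel \<Rightarrow> 'b set \<Rightarrow> ('a \<rightharpoonup> 'b) set" where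
  "short_funs \<kappa> Y = (\<Union>i\<in>Field \<kappa>. funs (underS \<kappa> i) Y)"

definition cantor :: "'a rel \<Rightarrow> ('a \<rightharpoonup> nat) set" where
  "cantor \<kappa> = funs (Field \<kappa>) {0, 1}"

definition cone :: "'a rel \<Rightarrow> ('a \<rightharpoonup> nat) \<Rightarrow> ('a \<rightharpoonup> nat) set" where
  "cone \<kappa> \<nu> = {\<eta> \<in> cantor \<kappa>. \<nu> \<subseteq>\<^sub>m \<eta>}"

definition cantor_open :: "'a rel \<Rightarrow> ('a \<rightharpoonup> nat) set \<Rightarrow> bool" where
  "cantor_open \<kappa> A \<longleftrightarrow>
     A \<subseteq> cantor \<kappa> \<and> (\<forall>\<eta>\<in>A. \<exists>i\<in>Field \<kappa>. cone \<kappa> (\<eta> |` underS \<kappa> i) \<subseteq> A)"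

definition unbounded_in :: "'a rel \<Rightarrow> 'a set \<Rightarrow> 'a set \<Rightarrow> bool" where
  "unbounded_in \<kappa> C D \<longleftrightarrow> (\<forall>a\<in>D. \<exists>c\<in>C \<inter> D. a \<in> underS \<kappa> c)"

text \<open>
  Since the bound in \<^const>\<open>unbounded_in\<close> is strict, a nonzero \<open>\<delta>\<close> in which \<open>C\<close> is unbounded is
  automatically a limit ordinal.
\<close>

definition club :: "'a rel \<Rightarrow> 'a set \<Rightarrow> bool" where
  "club \<kappa> C \<longleftrightarrow>
     C \<subseteq> Field \<kappa> \<and> unbounded_in \<kappa> C (Field \<kappa>) \<and>
     (\<forall>\<delta>\<in>Field \<kappa>. underS \<kappa> \<delta> \<noteq> {} \<and> unbounded_in \<kappa> C (underS \<kappa> \<delta>) \<longrightarrow> \<delta> \<in> C)"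

definition CUB :: "'a rel \<Rightarrow> ('a \<rightharpoonup> nat) set" where
  "CUB \<kappa> = {\<eta> \<in> cantor \<kappa>. \<exists>C. club \<kappa> C \<and> (\<forall>i\<in>C. \<eta> i = Some 1)}"

end

theory Submission
  imports Defs
begin

text \<open>
  A club is coded by a function \<open>f\<close> with \<open>j < f j\<close> for all \<open>j\<close>, namely as the range of \<open>f\<close> together
  with the limit points of that range. Because \<open>f\<close> is increasing in this sense, whether \<open>\<delta>\<close> belongs
  to the coded club depends only on the restriction of \<open>f\<close> to \<open>\<delta>\<close>, so the requirement
  that \<open>\<eta>\<close> be \<open>1\<close> on the coded club splits into conditions relating \<open>f\<restriction>i\<close> to \<open>\<eta>\<restriction>i\<close>.
  As limit points are added explicitly, no assumption on the cofinality of \<open>\<kappa>\<close> is needed.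
\<close>

text \<open>The closure of \<open>D\<close> in the order topology. The clause
  \<open>underS \<kappa> \<delta> \<noteq> {}\<close> keeps out zero, below which every set is
  vacuously unbounded.\<close>

definition limit_closure :: "'a rel \<Rightarrow> 'a set \<Rightarrow> 'a set" where
  "limit_closure \<kappa> D =
     {\<delta> \<in> Field \<kappa>. \<delta> \<in> D \<or> underS \<kappa> \<delta> \<noteq> {} \<and> unbounded_in \<kappa> D (underS \<kappa> \<delta>)}"

definition progressive :: "'a rel \<Rightarrow> ('a \<rightharpoonup> 'a) \<Rightarrow> bool" where
  "progressive \<kappa> f \<longleftrightarrow> (\<forall>j y. f j = Some y \<longrightarrow> j \<in> underS \<kappa> y)"

text \<open>Progressiveness is put inside the set, so a \<open>\<nu>\<close> without it gives the
  empty set and the bad branches vanish from the union. Testing only points of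
  \<open>dom \<nu>\<close> is what makes the set open.\<close>

definition coded_nbhd :: "'a rel \<Rightarrow> ('a \<rightharpoonup> 'a) \<Rightarrow> ('a \<rightharpoonup> nat) set" where
  "coded_nbhd \<kappa> \<nu> =
     {\<eta> \<in> cantor \<kappa>. progressive \<kappa> \<nu> \<and> (\<forall>\<delta> \<in> dom \<nu> \<inter> limit_closure \<kappa> (ran \<nu>). \<eta> \<delta> = Some 1)}"

lemma underS_trans:
  assumes "Well_order r" "a \<in> underS r b" "b \<in> underS r c"
  shows "a \<in> underS r c"
  using assms unfolding order_on_defs well_order_on_def underS_def
  by (auto dest: transD antisymD)

lemma unbounded_in_mono: "unbounded_in r C X \<Longrightarrow> C \<subseteq> D \<Longrightarrow> unbounded_in r D X"
  unfolding unbounded_in_def by blast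

lemma limit_closure_mono: "C \<subseteq> D \<Longrightarrow> limit_closure r C \<subseteq> limit_closure r D"
  using unbounded_in_mono[of r C _ D] unfolding limit_closure_def by blast

lemma limit_closure_club: "club r C \<Longrightarrow> limit_closure r C = C"
  unfolding limit_closure_def club_def by blast

text \<open>A limit of limit points is a limit of \<open>D\<close>: a point \<open>c\<close> above
  \<open>a\<close> that is outside \<open>D\<close> is itself approached by \<open>D\<close>, so
  some element of \<open>D\<close> lies strictly between \<open>a\<close> and
  \<open>c\<close>.\<close>

lemma unbounded_in_limit_closure:
  assumes "Well_order r" "unbounded_in r (limit_closure r D) (underS r \<delta>)"
  shows "unbounded_in r D (underS r \<delta>)"
  unfolding unbounded_in_def
proof
  fix a assume "a \<in> underS r \<delta>"
  then obtain c where c: "c \<in> limit_closure r D" "c \<in> underS r \<delta>" "a \<in> underS r c"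
    using assms(2) unfolding unbounded_in_def by blast
  show "\<exists>d \<in> D \<inter> underS r \<delta>. a \<in> underS r d"
  proof (cases "c \<in> D")
    case True
    then show ?thesis using c by blast
  next
    case False
    then obtain d where "d \<in> D" "d \<in> underS r c" "a \<in> underS r d"
      using c unfolding limit_closure_def unbounded_in_def by blast
    then show ?thesis using underS_trans[OF assms(1) _ c(2)] by blast
  qed
qed

lemma club_limit_closure:
  assumes "Well_order r" "D \<subseteq> Field r" "unbounded_in r D (Field r)"
  shows "club r (limit_closure r D)"
proof -
  have "D \<subseteq> limit_closure r D"
    using assms(2) unfolding limit_closure_def by blast
  then have "unbounded_in r (limit_closure r D) (Field r)"
    using assms(3) unbounded_in_mono by blast
  moreover have "\<delta> \<in> limit_closure r D"
    if "\<delta> \<in> Field r" "underS r \<delta> \<noteq> {}" "unbounded_in r (limit_closure r D) (underS r \<delta>)" for \<delta>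
    using that unbounded_in_limit_closure[OF assms(1) that(3)] unfolding limit_closure_def by blast
  moreover have "limit_closure r D \<subseteq> Field r"
    unfolding limit_closure_def by blast
  ultimately show ?thesis
    unfolding club_def by blast
qed

text \<open>A value \<open>y = f j\<close> below \<open>i\<close> satisfies
  \<open>j < y < i\<close>, so the restriction to \<open>i\<close> already takes it. Whether
  \<open>\<delta> < i\<close> is in the closure depends only on values up to
  \<open>\<delta>\<close>.\<close>

lemma limit_closure_ran_restrict:
  assumes "Well_order r" "progressive r f" "\<delta> \<in> underS r i" "\<delta> \<in> limit_closure r (ran f)"
  shows "\<delta> \<in> limit_closure r (ran (f |` underS r i))"
proof -
  have ran: "y \<in> ran (f |` underS r i)" if y: "y \<in> ran f" "y \<in> underS r i" for y
  proof -
    obtain j where "f j = Some y" using y(1) unfolding ran_def by blast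
    moreover from this have "j \<in> underS r i"
      using assms(2) underS_trans[OF assms(1) _ y(2)] unfolding progressive_def by blast
    ultimately show ?thesis by (auto simp: ran_def restrict_map_def)
  qed
  moreover have "unbounded_in r (ran (f |` underS r i)) (underS r \<delta>)"
    if "unbounded_in r (ran f) (underS r \<delta>)"
    using that ran underS_trans[OF assms(1) _ assms(3)] unfolding unbounded_in_def by blast
  ultimately show ?thesis using assms(3,4) unfolding limit_closure_def by blast
qed

text \<open>Membership depends only on the coordinates below the length \<open>i\<close> of
  \<open>\<nu>\<close>, so this one \<open>i\<close> serves every \<open>\<eta>\<close>.\<close>

lemma cantor_open_coded_nbhd:
  assumes "\<nu> \<in> short_funs r Y"
  shows "cantor_open r (coded_nbhd r \<nu>)"
proof -
  obtain i where i: "i \<in> Field r" "dom \<nu> = underS r i"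
    using assms unfolding short_funs_def funs_def by blast
  have "cone r (\<eta> |` underS r i) \<subseteq> coded_nbhd r \<nu>" if \<eta>: "\<eta> \<in> coded_nbhd r \<nu>" for \<eta>
  proof
    fix \<eta>' assume \<eta>': "\<eta>' \<in> cone r (\<eta> |` underS r i)"
    have "\<eta>' \<delta> = Some 1" if "\<delta> \<in> underS r i" "\<eta> \<delta> = Some 1" for \<delta>
      using \<eta>' that by (auto simp: cone_def map_le_def restrict_map_def dom_def split: if_splits)
    then show "\<eta>' \<in> coded_nbhd r \<nu>"
      using \<eta> \<eta>' i(2) by (auto simp: coded_nbhd_def cone_def)
  qed
  moreover have "coded_nbhd r \<nu> \<subseteq> cantor r" unfolding coded_nbhd_def by blast
  ultimately show ?thesis using i(1) unfolding cantor_open_def by blast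
qed

text \<open>Both conditions on \<open>f\<close> are local: by \<open>limit\<close>, each argument
  \<open>j\<close> and each \<open>\<delta>\<close> lies below some \<open>i\<close>, where the
  restriction detects it. By \<open>ne\<close> the intersection has a member, which forces
  \<open>\<eta>\<close> into \<open>cantor r\<close>.\<close>

lemma coded_nbhd_restrict_iff:
  assumes r: "Well_order r" and limit: "\<And>a. a \<in> Field r \<Longrightarrow> \<exists>b \<in> Field r. a \<in> underS r b"
    and ne: "Field r \<noteq> {}" and f: "dom f = Field r"
  shows "\<eta> \<in> (\<Inter>i \<in> Field r. coded_nbhd r (f |` underS r i)) \<longleftrightarrow>
    \<eta> \<in> cantor r \<and> progressive r f \<and> (\<forall>\<delta> \<in> limit_closure r (ran f). \<eta> \<delta> = Some 1)"
    (is "?L \<longleftrightarrow> ?R")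
proof
  assume L: ?L
  have prog: "progressive r f"
    unfolding progressive_def
  proof (intro allI impI)
    fix j y assume jy: "f j = Some y"
    then obtain i where i: "i \<in> Field r" "j \<in> underS r i" using limit f by blast
    then have "progressive r (f |` underS r i)" using L unfolding coded_nbhd_def by blast
    moreover have "(f |` underS r i) j = Some y" using jy i by simp
    ultimately show "j \<in> underS r y" unfolding progressive_def by blast
  qed
  have "\<eta> \<delta> = Some 1" if \<delta>: "\<delta> \<in> limit_closure r (ran f)" for \<delta>
  proof -
    have "\<delta> \<in> Field r" using \<delta> unfolding limit_closure_def by blast
    then obtain i where i: "i \<in> Field r" "\<delta> \<in> underS r i" using limit by blast
    have "\<delta> \<in> dom (f |` underS r i)" using i \<open>\<delta> \<in> Field r\<close> f by auto
    then show ?thesis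
      using L i limit_closure_ran_restrict[OF r prog i(2) \<delta>] unfolding coded_nbhd_def by blast
  qed
  moreover have "\<eta> \<in> cantor r" using L ne unfolding coded_nbhd_def by blast
  ultimately show ?R using prog by blast
next
  assume R: ?R
  \<comment> \<open>Restricting \<open>f\<close> preserves progressiveness and shrinks the range,
    hence also its closure.\<close>
  have "\<eta> \<in> coded_nbhd r (f |` underS r i)" for i
  proof -
    have "progressive r (f |` underS r i)"
      using R unfolding progressive_def by (simp add: restrict_map_def)
    moreover have "limit_closure r (ran (f |` underS r i)) \<subseteq> limit_closure r (ran f)"
      by (rule limit_closure_mono) (auto simp: ran_def restrict_map_def split: if_splits)
    ultimately show ?thesis using R unfolding coded_nbhd_def by blast
  qed
  then show ?L by blast
qed

text \<open>The code need not recover the given club \<open>C\<close>: it suffices that the coded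
  club lies inside \<open>C\<close>, where \<open>\<eta>\<close> is 1.\<close>

lemma CUB_iff_progressive:
  assumes r: "Well_order r"
  shows "\<eta> \<in> CUB r \<longleftrightarrow> \<eta> \<in> cantor r \<and>
    (\<exists>f \<in> funs (Field r) (Field r).
      progressive r f \<and> (\<forall>\<delta> \<in> limit_closure r (ran f). \<eta> \<delta> = Some 1))"
    (is "?L \<longleftrightarrow> ?R")
proof
  assume ?L
  then obtain C where \<eta>: "\<eta> \<in> cantor r" and C: "club r C" "\<forall>i\<in>C. \<eta> i = Some 1"
    unfolding CUB_def by blast
  have "\<forall>a\<in>Field r. \<exists>c. c \<in> C \<inter> Field r \<and> a \<in> underS r c"
    using C(1) unfolding club_def unbounded_in_def by blast
  \<comment> \<open>\<open>g\<close> picks an element of \<open>C\<close> strictly above each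
    ordinal; strictness makes \<open>f\<close> progressive.\<close>
  then obtain g where g: "\<forall>a\<in>Field r. g a \<in> C \<inter> Field r \<and> a \<in> underS r (g a)"
    by metis
  define f where "f = (\<lambda>a. if a \<in> Field r then Some (g a) else None)"
  have "f \<in> funs (Field r) (Field r)" "progressive r f"
    using g by (auto simp: f_def funs_def progressive_def ran_def dom_def split: if_splits)
  moreover have "ran f \<subseteq> C"
    using g by (auto simp: f_def ran_def split: if_splits)
  then have "limit_closure r (ran f) \<subseteq> C"
    using limit_closure_mono limit_closure_club[OF C(1)] by metis
  ultimately show ?R using \<eta> C(2) by blast
next
  assume ?R
  then obtain f where \<eta>: "\<eta> \<in> cantor r" and f: "f \<in> funs (Field r) (Field r)" "progressive r f"
    and 1: "\<forall>\<delta> \<in> limit_closure r (ran f). \<eta> \<delta> = Some 1"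
    by blast
  \<comment> \<open>The value at \<open>a\<close> is itself the witness above
    \<open>a\<close>.\<close>
  have "unbounded_in r (ran f) (Field r)"
    unfolding unbounded_in_def
  proof
    fix a assume "a \<in> Field r"
    then obtain y where y: "f a = Some y" using f(1) unfolding funs_def by blast
    then have "y \<in> ran f" by (rule ranI)
    then show "\<exists>c \<in> ran f \<inter> Field r. a \<in> underS r c"
      using f y unfolding funs_def progressive_def by blast
  qed
  then have "club r (limit_closure r (ran f))"
    using f(1) by (intro club_limit_closure[OF r]) (auto simp: funs_def)
  then show ?L using \<eta> 1 unfolding CUB_def by blast
qed

theorem lemma4p1:
  fixes \<kappa> :: "'a rel"
  assumes "Card_order \<kappa>" and "uncountable (Field \<kappa>)"
  shows "\<exists>A :: ('a \<rightharpoonup> 'a) \<Rightarrow> ('a \<rightharpoonup> nat) set.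
    (\<forall>\<nu> \<in> short_funs \<kappa> (Field \<kappa>). cantor_open \<kappa> (A \<nu>)) \<and>
    CUB \<kappa> = (\<Union>f \<in> funs (Field \<kappa>) (Field \<kappa>). \<Inter>i \<in> Field \<kappa>. A (f |` underS \<kappa> i))"
proof -
  have r: "Well_order \<kappa>" using assms(1) by (rule Card_order_wo_rel[unfolded wo_rel_def])
  have inf: "infinite (Field \<kappa>)" using assms(2) by (rule uncountable_infinite)
  then have ne: "Field \<kappa> \<noteq> {}" by auto
  \<comment> \<open>An infinite cardinal is a limit ordinal.\<close>
  have limit: "\<exists>b \<in> Field \<kappa>. a \<in> underS \<kappa> b" if "a \<in> Field \<kappa>" for a
    using infinite_Card_order_limit[OF assms(1) inf that] unfolding underS_def by blast
  note iff = coded_nbhd_restrict_iff[OF r limit ne]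
  have "CUB \<kappa> = (\<Union>f \<in> funs (Field \<kappa>) (Field \<kappa>). \<Inter>i \<in> Field \<kappa>. coded_nbhd \<kappa> (f |` underS \<kappa> i))"
  proof (intro set_eqI)
    fix \<eta>
    have "\<eta> \<in> (\<Inter>i \<in> Field \<kappa>. coded_nbhd \<kappa> (f |` underS \<kappa> i)) \<longleftrightarrow> \<eta> \<in> cantor \<kappa> \<and>
        progressive \<kappa> f \<and> (\<forall>\<delta> \<in> limit_closure \<kappa> (ran f). \<eta> \<delta> = Some 1)"
      if "f \<in> funs (Field \<kappa>) (Field \<kappa>)" for f
      using that by (intro iff) (auto simp: funs_def)
    then show "\<eta> \<in> CUB \<kappa> \<longleftrightarrow>
        \<eta> \<in> (\<Union>f \<in> funs (Field \<kappa>) (Field \<kappa>). \<Inter>i \<in> Field \<kappa>. coded_nbhd \<kappa> (f |` underS \<kappa> i))"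
      unfolding CUB_iff_progressive[OF r] UN_iff by blast
  qed
  then show ?thesis
    using cantor_open_coded_nbhd by blast
qed

end
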